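(* Let $G_1$ be an $r_1$-regular graph on $n_1$ vertices and $m_1$ edges, and $G_2$ an arbitrary graph on $n_2$ vertices. Then, as an identity of rational functions in $x$, $$\phi(Q(G_1 \odot G_2); x) = (x-2)^{m_1-n_1} \cdot \prod_{i=1}^{n_2} (x-1-\nu_i(G_2))^{n_1} \cdot \prod_{i=1}^{n_1} \left( x^2 - (2+r_1+n_2+\Gamma_{Q(G_2)}(x-1))x + 2(r_1+n_2+\Gamma_{Q(G_2)}(x-1)) - \nu_i(G_1) \right).$$
   Context: All graphs are finite, simple and undirected. For a graph $G$, $A(G)$ is its adjacency matrix, $D(G)$ the diagonal matrix of vertex degrees, and $Q(G)=D(G)+A(G)$ its signless Laplacian matrix; $\phi(M;x)=\det(xI-M)$. The signless Laplacian eigenvalues of a graph $G$ on $n$ vertices are $\nu_1(G)\le\dots\le\nu_n(G)$. For an $n\times n$ matrix $M$, the $M$-coronal is the rational function $\Gamma_M(x)=\mathbf{1}_n^T(xI_n-M)^{-1}\mathbf{1}_n$, where $\mathbf{1}_n$ is the all-ones column vector; $\Gamma_M(x-1)$ denotes its evaluation at $x-1$. The subdivision graph $\mathcal{S}(G)$ is obtained from $G$ by inserting a new vertex into every edge of $G$. The subdivision-vertex corona $G_1\odot G_2$ of two vertex-disjoint graphs is the graph obtained from $\mathcal{S}(G_1)$ and $|V(G_1)|$ copies of $G_2$, all vertex-disjoint, by joining the $i$th vertex of $V(G_1)$ to every vertex in the $i$th copy of $G_2$. *)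

theory Defs
  imports
    "Jordan_Normal_Form.Char_Poly"
    "Jordan_Normal_Form.Gauss_Jordan_Elimination"
    "HOL-Computational_Algebra.Computational_Algebra"
begin

record 'a sgraph =
  verts :: "'a set"
  edges :: "'a set set"

definition simple_graph :: "'a sgraph \<Rightarrow> bool" where
  "simple_graph G \<longleftrightarrow> finite (verts G) \<and> (\<forall>e\<in>edges G. e \<subseteq> verts G \<and> card e = 2)"

definition vertex_degree :: "'a sgraph \<Rightarrow> 'a \<Rightarrow> nat" where
  "vertex_degree G v = card {e \<in> edges G. v \<in> e}"

definition regular_graph :: "nat \<Rightarrow> 'a sgraph \<Rightarrow> bool" where
  "regular_graph r G \<longleftrightarrow> (\<forall>v\<in>verts G. vertex_degree G v = r)"

text \<open>The matrices of a graph are taken with respect to an ordering of its vertices.\<close>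

definition vertex_ordering :: "'a sgraph \<Rightarrow> 'a list \<Rightarrow> bool" where
  "vertex_ordering G vs \<longleftrightarrow> distinct vs \<and> set vs = verts G"

definition adjacency_matrix :: "'a sgraph \<Rightarrow> 'a list \<Rightarrow> real mat" where
  "adjacency_matrix G vs =
     mat (length vs) (length vs) (\<lambda>(i, j). if {vs ! i, vs ! j} \<in> edges G then 1 else 0)"

definition degree_matrix :: "'a sgraph \<Rightarrow> 'a list \<Rightarrow> real mat" where
  "degree_matrix G vs =
     mat (length vs) (length vs) (\<lambda>(i, j). if i = j then real (vertex_degree G (vs ! i)) else 0)"

definition signless_laplacian :: "'a sgraph \<Rightarrow> 'a list \<Rightarrow> real mat" where
  "signless_laplacian G vs = degree_matrix G vs + adjacency_matrix G vs"

text \<open>The \<open>i\<close>-th smallest signless Laplacian eigenvalue, counted with algebraic multiplicity;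
  indices start at 1.\<close>

definition signless_eigenvalue :: "'a sgraph \<Rightarrow> 'a list \<Rightarrow> nat \<Rightarrow> real" where
  "signless_eigenvalue G vs i =
     sorted_list_of_multiset (proots (char_poly (signless_laplacian G vs))) ! (i - 1)"

definition subdivision_graph :: "'a sgraph \<Rightarrow> ('a + 'a set) sgraph" where
  "subdivision_graph G =
     \<lparr>verts = Inl ` verts G \<union> Inr ` edges G,
      edges = {{Inl v, Inr e} | v e. e \<in> edges G \<and> v \<in> e}\<rparr>"

text \<open>The vertex \<open>Inr (u, w)\<close> is the vertex \<open>w\<close> in the copy of \<open>G2\<close> that belongs to \<open>u\<close>.\<close>

definition subdivision_vertex_corona ::
  "'a sgraph \<Rightarrow> 'b sgraph \<Rightarrow> (('a + 'a set) + 'a \<times> 'b) sgraph" where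
  "subdivision_vertex_corona G1 G2 =
     \<lparr>verts = Inl ` verts (subdivision_graph G1) \<union> Inr ` (verts G1 \<times> verts G2),
      edges = (\<lambda>e. Inl ` e) ` edges (subdivision_graph G1)
            \<union> {(\<lambda>w. Inr (u, w)) ` e | u e. u \<in> verts G1 \<and> e \<in> edges G2}
            \<union> {{Inl (Inl u), Inr (u, w)} | u w. u \<in> verts G1 \<and> w \<in> verts G2}\<rparr>"

text \<open>Rational functions over the reals are elements of \<^typ>\<open>real poly fract\<close>.\<close>

definition ratfun_X :: "real poly fract" where
  "ratfun_X = to_fract [:0, 1:]"

definition ratfun_const :: "real \<Rightarrow> real poly fract" where
  "ratfun_const c = to_fract [:c:]"

text \<open>The substitution \<open>f(x) \<mapsto> f(x + c)\<close>, on numerator and denominator of any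
  representation of \<open>f\<close> as a fraction; the lemma below shows well-definedness.\<close>

definition ratfun_shift :: "real \<Rightarrow> real poly fract \<Rightarrow> real poly fract" where
  "ratfun_shift c f =
     (THE g. \<forall>a b. b \<noteq> 0 \<longrightarrow> f = Fract a b \<longrightarrow> g = Fract (pcompose a [:c, 1:]) (pcompose b [:c, 1:]))"

lemma ratfun_shift_Fract:
  assumes "b \<noteq> 0"
  shows "ratfun_shift c (Fract a b) = Fract (pcompose a [:c, 1:]) (pcompose b [:c, 1:])"
proof -
  have nz: "pcompose p [:c, 1:] \<noteq> 0" if "p \<noteq> 0" for p :: "real poly"
  proof
    assume "pcompose p [:c, 1:] = 0"
    then have "p = 0" by (rule pcompose_eq_0) simp
    with that show False by simp
  qed
  have "Fract (pcompose a [:c, 1:]) (pcompose b [:c, 1:]) =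
      Fract (pcompose a' [:c, 1:]) (pcompose b' [:c, 1:])"
    if "b' \<noteq> 0" "Fract a b = Fract a' b'" for a' b'
  proof -
    have "a * b' = a' * b" using that assms by (simp add: eq_fract)
    then have "pcompose a [:c, 1:] * pcompose b' [:c, 1:] =
        pcompose a' [:c, 1:] * pcompose b [:c, 1:]"
      by (simp flip: pcompose_mult)
    then show ?thesis using nz that(1) assms by (simp add: eq_fract)
  qed
  then show ?thesis
    unfolding ratfun_shift_def using assms by (intro the_equality) blast+
qed

text \<open>Note that \<open>char_poly_matrix M\<close> is \<open>x I - M\<close>; it is invertible over the rational functions.\<close>

definition coronal :: "real mat \<Rightarrow> real poly fract" where
  "coronal M =
     (let one = vec (dim_row M) (\<lambda>_. 1)
      in one \<bullet> (the (mat_inverse (map_mat to_fract (char_poly_matrix M))) *\<^sub>v one))"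

end

theory Submission
  imports Defs
begin

text \<open>Order the vertices of the corona as edges of \<open>G1\<close>, vertices of the copies of \<open>G2\<close>,
  vertices of \<open>G1\<close>. The block of \<open>x I - Q\<close> belonging to the first two kinds is block diagonal,
  with blocks \<open>(x - 2) I\<close> and \<open>(x - 1) I - Q(G2)\<close>. The Schur complement of this block is
  \<open>(x - r1 - n2) I - R R\<^sup>T / (x - 2) - \<Gamma> I\<close>, where \<open>R\<close> is the vertex-edge incidence matrix of \<open>G1\<close>
  and \<open>\<Gamma>\<close> is the coronal at \<open>x - 1\<close>. Since \<open>R R\<^sup>T = Q(G1)\<close>, it is \<open>1 / (x - 2)\<close> times
  \<open>c I - Q(G1)\<close> with \<open>c = (x - 2) (x - r1 - n2 - \<Gamma>)\<close>, whose determinant splits over the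
  eigenvalues of \<open>Q(G1)\<close>.\<close>

section \<open>Real symmetric matrices\<close>

interpretation to_fract: comm_ring_hom "to_fract :: 'a :: idom \<Rightarrow> 'a fract"
  by unfold_locales simp_all

text \<open>Serves two coefficient extensions: from the reals to the complex numbers, and from the
  reals to rational functions.\<close>

lemma (in comm_ring_hom) map_poly_hom_linear_factors:
  "map_poly hom (\<Prod>a\<leftarrow>as. [:- a, 1:]) = (\<Prod>a\<leftarrow>as. [:- hom a, 1:])"
proof -
  interpret map_poly_hom: map_poly_comm_ring_hom hom ..
  show ?thesis
    by (induction as) (simp_all add: map_poly_hom.hom_mult hom_uminus del: mult_pCons_left)
qed

text \<open>For an eigenvector v, the Hermitian form \<open>q\<close> equals \<open>k\<close> times
  the squared norm \<open>s\<close>. Symmetry of the real matrix makes \<open>q\<close> its own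
  conjugate, and \<open>s\<close> is positive, so \<open>k\<close> equals its conjugate.\<close>

lemma symmetric_mat_complex_eigenvalue_real:
  fixes A :: "real mat"
  assumes A: "A \<in> carrier_mat n n"
    and sym: "\<And>i j. i < n \<Longrightarrow> j < n \<Longrightarrow> A $$ (i, j) = A $$ (j, i)"
    and ev: "eigenvalue (map_mat complex_of_real A) k"
  shows "k \<in> \<real>"
proof -
  from ev A obtain v where v: "dim_vec v = n" "v \<noteq> 0\<^sub>v n"
    and Av: "map_mat complex_of_real A *\<^sub>v v = k \<cdot>\<^sub>v v"
    unfolding eigenvalue_def eigenvector_def by (metis carrier_matD(1) carrier_vecD index_map_mat(2))
  have row: "(\<Sum>j<n. of_real (A $$ (i, j)) * v $ j) = k * v $ i" if "i < n" for i
    using arg_cong[OF Av, of "\<lambda>w. vec_index w i"] that A v(1)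
    by (simp add: scalar_prod_def atLeast0LessThan)
  define s where "s = (\<Sum>i<n. (cmod (v $ i))\<^sup>2)"
  define q where "q = (\<Sum>i<n. \<Sum>j<n. cnj (v $ i) * of_real (A $$ (i, j)) * v $ j)"
  have "q = (\<Sum>i<n. cnj (v $ i) * (k * v $ i))"
    unfolding q_def by (intro sum.cong refl) (simp flip: row add: sum_distrib_left mult.assoc)
  also have "\<dots> = k * of_real s"
    by (simp only: s_def of_real_sum complex_norm_square sum_distrib_left mult_ac)
  finally have qs: "q = k * of_real s" .
  have "cnj q = (\<Sum>i<n. \<Sum>j<n. v $ i * of_real (A $$ (i, j)) * cnj (v $ j))"
    by (simp add: q_def)
  also have "\<dots> = (\<Sum>j<n. \<Sum>i<n. v $ i * of_real (A $$ (i, j)) * cnj (v $ j))"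
    by (rule sum.swap)
  also have "\<dots> = q"
    unfolding q_def by (intro sum.cong refl) (simp add: sym mult_ac)
  finally have "cnj k * of_real s = k * of_real s" by (simp add: qs)
  moreover obtain i where "i < n" "v $ i \<noteq> 0"
    using v by (metis eq_vecI index_zero_vec(1) index_zero_vec(2))
  then have "s > 0" unfolding s_def by (intro sum_pos2[of _ i]) auto
  ultimately have "cnj k = k" by simp
  then show ?thesis by (simp add: Reals_cnj_iff)
qed

text \<open>The characteristic polynomial splits over the complex numbers, and its roots are
  eigenvalues, hence real. Real polynomials embed injectively into complex ones, so the splitting
  holds over the reals. The size statement ensures that \<open>signless_eigenvalue\<close> stays
  inside its list for indices 1 to n.\<close>

lemma char_poly_symmetric_mat_proots:
  fixes A :: "real mat"
  assumes A: "A \<in> carrier_mat n n"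
    and sym: "\<And>i j. i < n \<Longrightarrow> j < n \<Longrightarrow> A $$ (i, j) = A $$ (j, i)"
  shows "char_poly A = (\<Prod>a\<in>#proots (char_poly A). [:- a, 1:])"
    and "size (proots (char_poly A)) = n"
proof -
  let ?C = "map_mat complex_of_real A"
  have C: "?C \<in> carrier_mat n n" using A by simp
  obtain as where as: "char_poly ?C = (\<Prod>a\<leftarrow>as. [:- a, 1:])" "length as = n"
    using char_poly_factorized[OF C] by blast
  have "of_real (Re a) = a" if "a \<in> set as" for a
  proof -
    have "poly (char_poly ?C) a = 0"
      using that by (simp add: as poly_prod_list prod_list_zero_iff image_iff)
    then have "eigenvalue ?C a" using eigenvalue_root_char_poly[OF C] by blast
    then show ?thesis using symmetric_mat_complex_eigenvalue_real[OF A sym] by (auto elim: Reals_cases)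
  qed
  then have "map (\<lambda>a. [:- a, 1:]) as = map (\<lambda>a. [:- of_real a, 1:]) (map Re as)" by simp
  then have "map_poly complex_of_real (char_poly A) = (\<Prod>a\<leftarrow>map Re as. [:- of_real a, 1:])"
    by (simp only: as flip: of_real_hom.char_poly_hom[OF A])
  also have "\<dots> = map_poly complex_of_real (\<Prod>a\<leftarrow>map Re as. [:- a, 1:])"
    by (simp only: of_real_hom.map_poly_hom_linear_factors)
  finally have eq: "char_poly A = (\<Prod>a\<leftarrow>map Re as. [:- a, 1:])"
    by (simp add: poly_eq_iff)
  have pr: "proots (\<Prod>a\<leftarrow>bs. [:- a, 1:]) = mset bs" for bs :: "real list"
  proof (induction bs)
    case (Cons b bs)
    have "(\<Prod>a\<leftarrow>bs. [:- a, 1:]) \<noteq> 0" by (auto simp: prod_list_zero_iff)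
    then show ?case using Cons by (simp add: proots_mult del: mult_pCons_left)
  qed simp
  show "size (proots (char_poly A)) = n" using as by (simp only: eq pr size_mset length_map)
  show "char_poly A = (\<Prod>a\<in>#proots (char_poly A). [:- a, 1:])"
    by (simp only: eq pr) (simp only: mset_map[symmetric] prod_mset_prod_list)
qed

section \<open>Matrices indexed by lists\<close>

text \<open>Labels replace positions: products become sums over sets of labels, appended lists give
  blocks, and reordering needs no index arithmetic.\<close>

definition indexed_mat :: "'i list \<Rightarrow> 'j list \<Rightarrow> ('i \<Rightarrow> 'j \<Rightarrow> 'a) \<Rightarrow> 'a mat" where
  "indexed_mat xs ys f = mat (length xs) (length ys) (\<lambda>(i, j). f (xs ! i) (ys ! j))"

lemma indexed_mat_carrier [simp]: "indexed_mat xs ys f \<in> carrier_mat (length xs) (length ys)"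
  by (simp add: indexed_mat_def)

lemma dim_indexed_mat [simp]:
  "dim_row (indexed_mat xs ys f) = length xs" "dim_col (indexed_mat xs ys f) = length ys"
  by (simp_all add: indexed_mat_def)

lemma index_indexed_mat [simp]:
  "i < length xs \<Longrightarrow> j < length ys \<Longrightarrow> indexed_mat xs ys f $$ (i, j) = f (xs ! i) (ys ! j)"
  by (simp add: indexed_mat_def)

lemma indexed_mat_cong:
  assumes "\<And>x y. x \<in> set xs \<Longrightarrow> y \<in> set ys \<Longrightarrow> f x y = g x y"
  shows "indexed_mat xs ys f = indexed_mat xs ys g"
  using assms by (intro eq_matI) auto

lemma indexed_mat_map:
  "indexed_mat (map g xs) (map h ys) f = indexed_mat xs ys (\<lambda>x y. f (g x) (h y))"
  by (intro eq_matI) auto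

lemma indexed_mat_mult:
  assumes "distinct ys"
  shows "indexed_mat xs ys f * indexed_mat ys zs g =
    indexed_mat xs zs (\<lambda>x z. \<Sum>y\<in>set ys. f x y * g y z)"
proof (intro eq_matI, goal_cases)
  case (1 i j)
  have "(\<Sum>k<length ys. f (xs ! i) (ys ! k) * g (ys ! k) (zs ! j)) =
      (\<Sum>y\<in>set ys. f (xs ! i) y * g y (zs ! j))"
    using bij_betw_nth[OF assms refl refl] by (rule sum.reindex_bij_betw)
  then show ?case using 1 by (simp add: scalar_prod_def atLeast0LessThan)
qed simp_all

lemma indexed_mat_append:
  "indexed_mat (xs @ xs') (ys @ ys') f =
    four_block_mat (indexed_mat xs ys f) (indexed_mat xs ys' f)
      (indexed_mat xs' ys f) (indexed_mat xs' ys' f)"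
  by (intro eq_matI) (auto simp: nth_append)

lemma indexed_mat_delta:
  "distinct xs \<Longrightarrow> indexed_mat xs xs (\<lambda>x y. if x = y then 1 else 0) = 1\<^sub>m (length xs)"
  by (intro eq_matI) (auto simp: nth_eq_iff_index_eq)

lemma indexed_mat_delta_mult:
  fixes f :: "'i \<Rightarrow> 'j \<Rightarrow> 'a :: semiring_1"
  assumes "distinct ys" "set xs \<subseteq> set ys"
  shows "indexed_mat xs ys (\<lambda>x y. if x = y then 1 else 0) * indexed_mat ys zs f = indexed_mat xs zs f"
  using assms by (auto simp: indexed_mat_mult mult_delta_left intro!: indexed_mat_cong)

lemma indexed_mat_mult_delta:
  fixes f :: "'i \<Rightarrow> 'j \<Rightarrow> 'a :: semiring_1"
  assumes "distinct ys" "set zs \<subseteq> set ys"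
  shows "indexed_mat xs ys f * indexed_mat ys zs (\<lambda>y z. if y = z then 1 else 0) = indexed_mat xs zs f"
  using assms by (auto simp: indexed_mat_mult mult_delta_right intro!: indexed_mat_cong)

section \<open>Determinants of labelled matrices\<close>

lemma det_indexed_mat_reorder:
  fixes f :: "'i \<Rightarrow> 'i \<Rightarrow> 'a :: comm_ring_1"
  assumes xs: "distinct xs" and ys: "distinct ys" and eq: "set xs = set ys"
  shows "det (indexed_mat xs xs f) = det (indexed_mat ys ys f)"
proof (rule det_similar, rule similar_matI)
  \<comment> \<open>The delta matrices between the two orderings are mutually inverse permutation
    matrices, so simultaneous reordering of rows and columns is a similarity.\<close>
  let ?\<delta> = "\<lambda>x y :: 'i. if x = y then 1 else 0 :: 'a"
  have len: "length ys = length xs" using assms by (metis distinct_card)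
  show "{indexed_mat xs xs f, indexed_mat ys ys f, indexed_mat xs ys ?\<delta>, indexed_mat ys xs ?\<delta>}
      \<subseteq> carrier_mat (length xs) (length xs)"
    by (auto simp: indexed_mat_def len)
  show "indexed_mat xs ys ?\<delta> * indexed_mat ys xs ?\<delta> = 1\<^sub>m (length xs)"
    "indexed_mat ys xs ?\<delta> * indexed_mat xs ys ?\<delta> = 1\<^sub>m (length xs)"
    using assms len by (simp_all add: indexed_mat_delta_mult indexed_mat_delta)
  show "indexed_mat xs xs f = indexed_mat xs ys ?\<delta> * indexed_mat ys ys f * indexed_mat ys xs ?\<delta>"
    using assms by (simp add: indexed_mat_delta_mult indexed_mat_mult_delta)
qed

lemma det_indexed_mat_append_triangular:
  fixes f :: "'i \<Rightarrow> 'i \<Rightarrow> 'a :: idom"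
  assumes "\<And>x y. x \<in> set xs \<Longrightarrow> y \<in> set ys \<Longrightarrow> f y x = 0"
  shows "det (indexed_mat (xs @ ys) (xs @ ys) f) = det (indexed_mat xs xs f) * det (indexed_mat ys ys f)"
proof -
  have "indexed_mat ys xs f = 0\<^sub>m (length ys) (length xs)"
    using assms by (intro eq_matI) auto
  then show ?thesis unfolding indexed_mat_append
    by (intro det_four_block_mat_lower_left_zero[of _ "length xs" _ "length ys"]) simp_all
qed

text \<open>\<open>Y\<close> stands for the inverse of \<open>A\<close> times the upper right block.
  Taking it as given avoids inverting \<open>A\<close>, so the formula holds over any integral
  domain, even for singular \<open>A\<close>.\<close>

lemma det_four_block_mat_schur:
  fixes A :: "'a :: idom mat"
  assumes A: "A \<in> carrier_mat n n" and C: "C \<in> carrier_mat m n" and D: "D \<in> carrier_mat m m"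
    and Y: "Y \<in> carrier_mat n m"
  shows "det (four_block_mat A (A * Y) C D) = det A * det (D - C * Y)"
proof -
  \<comment> \<open>Block LU factorization: the identity blocks leave \<open>det A\<close> from the
    first factor and \<open>det (D - C * Y)\<close> from the second.\<close>
  have "four_block_mat A (0\<^sub>m n m) C (1\<^sub>m m) * four_block_mat (1\<^sub>m n) Y (0\<^sub>m m n) (D - C * Y) =
      four_block_mat A (A * Y) C D"
  proof -
    have "C * Y + (D - C * Y) = D" using C D Y by (intro eq_matI) auto
    then show ?thesis using assms
      by (subst mult_four_block_mat[of _ n n _ m _ m _ _ n _ m]) auto
  qed
  then have "det (four_block_mat A (A * Y) C D) =
      det (four_block_mat A (0\<^sub>m n m) C (1\<^sub>m m)) * det (four_block_mat (1\<^sub>m n) Y (0\<^sub>m m n) (D - C * Y))"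
    using assms by (metis det_mult four_block_carrier_mat minus_carrier_mat mult_carrier_mat one_carrier_mat)
  also have "det (four_block_mat A (0\<^sub>m n m) C (1\<^sub>m m)) = det A"
    using assms by (subst det_four_block_mat_upper_right_zero[of _ n _ m]) auto
  also have "det (four_block_mat (1\<^sub>m n) Y (0\<^sub>m m n) (D - C * Y)) = det (D - C * Y)"
    using assms by (subst det_four_block_mat_lower_left_zero[of _ n _ m]) auto
  finally show ?thesis .
qed

text \<open>To apply this it suffices to exhibit a solution \<open>Y\<close> of the linear systems
  whose right-hand sides are the columns of the upper right block.\<close>

lemma det_indexed_mat_append_schur:
  fixes f :: "'i \<Rightarrow> 'i \<Rightarrow> 'a :: idom"
  assumes "distinct xs"
    and Y: "\<And>x y. x \<in> set xs \<Longrightarrow> y \<in> set ys \<Longrightarrow> (\<Sum>x'\<in>set xs. f x x' * Y x' y) = f x y"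
  shows "det (indexed_mat (xs @ ys) (xs @ ys) f) = det (indexed_mat xs xs f) *
    det (indexed_mat ys ys (\<lambda>y y'. f y y' - (\<Sum>x\<in>set xs. f y x * Y x y')))"
proof -
  have "indexed_mat xs ys f = indexed_mat xs xs f * indexed_mat xs ys Y"
    using assms by (auto simp: indexed_mat_mult intro!: indexed_mat_cong)
  moreover have "indexed_mat ys ys f - indexed_mat ys xs f * indexed_mat xs ys Y =
      indexed_mat ys ys (\<lambda>y y'. f y y' - (\<Sum>x\<in>set xs. f y x * Y x y'))"
    using assms(1) by (simp add: indexed_mat_mult) (intro eq_matI; simp)
  ultimately show ?thesis
    unfolding indexed_mat_append
    by (simp add: det_four_block_mat_schur[of _ "length xs" _ "length ys"])
qed

lemma det_indexed_mat_smult: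
  "det (indexed_mat xs xs (\<lambda>x y. c * f x y)) = c ^ length xs * det (indexed_mat xs xs f)"
proof -
  have "indexed_mat xs xs (\<lambda>x y. c * f x y) = c \<cdot>\<^sub>m indexed_mat xs xs f"
    by (intro eq_matI) auto
  then show ?thesis by simp
qed

lemma det_indexed_mat_scalar:
  "distinct xs \<Longrightarrow> det (indexed_mat xs xs (\<lambda>x y. if x = y then c else 0)) = c ^ length xs"
  using det_indexed_mat_smult[of xs c "\<lambda>x y. if x = y then 1 else 0"]
  by (simp add: indexed_mat_delta if_distrib cong: if_cong)

text \<open>\<open>List.product\<close> groups the pairs by first component, so the matrix is block
  diagonal with one block per entry of \<open>us\<close>; the induction splits off one block at a
  time.\<close>

lemma det_indexed_mat_product:
  fixes f :: "'j \<Rightarrow> 'j \<Rightarrow> 'a :: idom"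
  assumes "distinct us"
  shows "det (indexed_mat (List.product us ws) (List.product us ws)
      (\<lambda>(u, w) (u', w'). if u = u' then f w w' else 0)) = det (indexed_mat ws ws f) ^ length us"
  using assms
proof (induction us)
  case Nil
  then show ?case by (simp add: indexed_mat_def)
next
  case (Cons u us)
  then show ?case
    by (simp, subst det_indexed_mat_append_triangular) (auto simp: indexed_mat_map)
qed

section \<open>Rational functions and the coronal\<close>

interpretation ratfun_const: comm_ring_hom ratfun_const
  by unfold_locales (simp_all add: ratfun_const_def flip: to_fract_add to_fract_mult one_pCons)

lemma ratfun_shift_add: "ratfun_shift c (f + g) = ratfun_shift c f + ratfun_shift c g"
proof (cases f rule: Fract_cases, cases g rule: Fract_cases)
  fix a b a' b' :: "real poly"
  assume "f = Fract a b" "b \<noteq> 0" "g = Fract a' b'" "b' \<noteq> 0"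
  \<comment> \<open>Adding two fractions requires nonzero denominators, both before and after the
    substitution.\<close>
  moreover from this have "pcompose b [:c, 1:] \<noteq> 0" "pcompose b' [:c, 1:] \<noteq> 0"
    by (simp_all add: pcompose_eq_0_iff)
  ultimately show ?thesis
    by (simp add: ratfun_shift_Fract pcompose_add pcompose_mult)
qed

lemma ratfun_shift_mult: "ratfun_shift c (f * g) = ratfun_shift c f * ratfun_shift c g"
proof (cases f rule: Fract_cases, cases g rule: Fract_cases)
  fix a b a' b' :: "real poly"
  assume "f = Fract a b" "b \<noteq> 0" "g = Fract a' b'" "b' \<noteq> 0"
  then show ?thesis
    by (simp add: ratfun_shift_Fract pcompose_mult)
qed

lemma ratfun_shift_to_fract: "ratfun_shift c (to_fract p) = to_fract (pcompose p [:c, 1:])"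
  by (simp add: to_fract_def ratfun_shift_Fract pcompose_1)

text \<open>As a ring homomorphism, the shift carries a linear system over the rational functions to
  the shifted system. The coronal can thus be evaluated at another argument without commuting
  substitution and matrix inversion.\<close>

interpretation ratfun_shift: comm_ring_hom "ratfun_shift c" for c
proof
  show "ratfun_shift c 0 = 0" using ratfun_shift_to_fract[of c 0] by simp
  show "ratfun_shift c 1 = 1" using ratfun_shift_to_fract[of c 1] by (simp add: pcompose_1)
qed (simp_all add: ratfun_shift_add ratfun_shift_mult)

section \<open>The matrices c I - Q, their determinants and the coronal\<close>

definition signless_entry :: "'a sgraph \<Rightarrow> 'a \<Rightarrow> 'a \<Rightarrow> real" where
  "signless_entry G u v =
     (if u = v then real (vertex_degree G u) else 0) + (if {u, v} \<in> edges G then 1 else 0)"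

text \<open>The scalar \<open>c\<close> is a free rational function because several values occur: x
  for the corona, x - 1 for the copies of \<open>G2\<close>, and the scalar produced by the Schur
  complement for \<open>G1\<close>.\<close>

definition signless_pencil :: "real poly fract \<Rightarrow> 'a sgraph \<Rightarrow> 'a \<Rightarrow> 'a \<Rightarrow> real poly fract" where
  "signless_pencil c G u v = (if u = v then c else 0) - ratfun_const (signless_entry G u v)"

lemma signless_laplacian_indexed_mat:
  "distinct vs \<Longrightarrow> signless_laplacian G vs = indexed_mat vs vs (signless_entry G)"
  unfolding signless_laplacian_def degree_matrix_def adjacency_matrix_def
  by (intro eq_matI) (auto simp: signless_entry_def nth_eq_iff_index_eq)

lemma char_poly_matrix_signless_laplacian:
  assumes "distinct vs"
  shows "map_mat to_fract (char_poly_matrix (signless_laplacian G vs)) =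
    indexed_mat vs vs (signless_pencil ratfun_X G)"
  unfolding char_poly_matrix_def using assms
  by (intro eq_matI)
    (auto simp: signless_laplacian_indexed_mat signless_pencil_def ratfun_X_def ratfun_const_def
      nth_eq_iff_index_eq simp flip: to_fract_diff to_fract_uminus)

lemma to_fract_char_poly_signless_laplacian:
  "distinct vs \<Longrightarrow> to_fract (char_poly (signless_laplacian G vs)) =
    det (indexed_mat vs vs (signless_pencil ratfun_X G))"
  by (simp add: char_poly_def to_fract.hom_det[symmetric] char_poly_matrix_signless_laplacian
      del: to_fract.hom_det)

text \<open>Q is real symmetric, so its characteristic polynomial has n real linear factors. With
  coefficients extended to rational functions, it can be evaluated at \<open>c\<close>.\<close>

lemma det_signless_pencil:
  assumes vs: "distinct vs"
  shows "det (indexed_mat vs vs (signless_pencil c G)) =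
    (\<Prod>i=1..length vs. c - ratfun_const (signless_eigenvalue G vs i))"
proof -
  let ?Q = "signless_laplacian G vs" and ?n = "length vs"
  let ?l = "sorted_list_of_multiset (proots (char_poly ?Q))"
  have Q: "?Q \<in> carrier_mat ?n ?n" by (simp add: signless_laplacian_indexed_mat[OF vs])
  have sym: "?Q $$ (i, j) = ?Q $$ (j, i)" if "i < ?n" "j < ?n" for i j
    using that vs by (simp add: signless_laplacian_indexed_mat[OF vs] signless_entry_def insert_commute)
  have len: "length ?l = ?n"
    using char_poly_symmetric_mat_proots(2)[OF Q sym] by (metis mset_sorted_list_of_multiset size_mset)
  have "char_poly ?Q = (\<Prod>a\<leftarrow>?l. [:- a, 1:])"
    using char_poly_symmetric_mat_proots(1)[OF Q sym]
    by (metis mset_map mset_sorted_list_of_multiset prod_mset_prod_list)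
  then have "char_poly (map_mat ratfun_const ?Q) = map_poly ratfun_const (\<Prod>a\<leftarrow>?l. [:- a, 1:])"
    by (simp only: ratfun_const.char_poly_hom[OF Q])
  also have "\<dots> = (\<Prod>a\<leftarrow>?l. [:- ratfun_const a, 1:])"
    by (rule ratfun_const.map_poly_hom_linear_factors)
  finally have cp: "char_poly (map_mat ratfun_const ?Q) = (\<Prod>a\<leftarrow>?l. [:- ratfun_const a, 1:])" .
  \<comment> \<open>\<open>char_matrix A c\<close> is A - c I, whence the sign.\<close>
  have "indexed_mat vs vs (signless_pencil c G) = - char_matrix (map_mat ratfun_const ?Q) c"
    unfolding char_matrix_def using vs
    by (intro eq_matI)
      (auto simp: signless_laplacian_indexed_mat signless_pencil_def nth_eq_iff_index_eq)
  then have "det (indexed_mat vs vs (signless_pencil c G)) =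
      poly (char_poly (map_mat ratfun_const ?Q)) c"
    using Q by (subst char_poly_matrix[of _ ?n]) simp_all
  also have "\<dots> = (\<Prod>a\<leftarrow>?l. c - ratfun_const a)"
    by (simp add: cp poly_prod_list o_def)
  also have "\<dots> = (\<Prod>i<?n. c - ratfun_const (?l ! i))"
    by (simp add: prod.list_conv_set_nth len atLeast0LessThan)
  also have "\<dots> = (\<Prod>i=1..?n. c - ratfun_const (signless_eigenvalue G vs i))"
    by (simp add: prod.atLeast1_atMost_eq signless_eigenvalue_def)
  finally show ?thesis .
qed

text \<open>The values \<open>w v\<close> are the coordinates of the vector \<open>(x I - Q)\<^sup>-\<^sup>1 1\<close> evaluated at \<open>x + c\<close>.\<close>

lemma coronal_solution:
  assumes vs: "distinct vs"
  obtains w where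
    "\<And>u. u \<in> set vs \<Longrightarrow> (\<Sum>v\<in>set vs. signless_pencil (ratfun_X + ratfun_const c) G u v * w v) = 1"
    "(\<Sum>v\<in>set vs. w v) = ratfun_shift c (coronal (signless_laplacian G vs))"
proof -
  let ?Q = "signless_laplacian G vs" and ?n = "length vs"
  let ?M = "indexed_mat vs vs (signless_pencil ratfun_X G)"
  let ?one = "vec ?n (\<lambda>_. 1 :: real poly fract)"
  have Q: "?Q \<in> carrier_mat ?n ?n" by (simp add: signless_laplacian_indexed_mat[OF vs])
  have M: "?M \<in> carrier_mat ?n ?n" by simp
  \<comment> \<open>A characteristic polynomial is monic, hence nonzero, so \<open>?M\<close> is
    invertible over the rational functions and the \<open>the\<close> in \<open>coronal\<close>
    meets a \<open>Some\<close>.\<close>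
  have "char_poly ?Q \<noteq> 0" using degree_monic_char_poly[OF Q] by auto
  then have "det ?M \<noteq> 0"
    by (simp flip: to_fract_char_poly_signless_laplacian[OF vs])
  then obtain B where B: "mat_inverse ?M = Some B"
    using mat_inverse(1)[OF M] det_non_zero_imp_unit[OF M] by (metis not_None_eq)
  then have MB: "?M * B = 1\<^sub>m ?n" "B \<in> carrier_mat ?n ?n" using mat_inverse(2)[OF M] by auto
  define b where "b = B *\<^sub>v ?one"
  have dimb: "dim_vec b = ?n" using MB by (simp add: b_def)
  have "?M *\<^sub>v b = (?M * B) *\<^sub>v ?one"
    unfolding b_def using MB(2) by (intro assoc_mult_mat_vec[symmetric]) auto
  then have Mb: "?M *\<^sub>v b = ?one" by (simp add: MB)
  have cor: "coronal ?Q = (\<Sum>i<?n. b $ i)"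
    using Q dimb unfolding coronal_def char_poly_matrix_signless_laplacian[OF vs] B Let_def
    by (simp add: scalar_prod_def b_def[symmetric] atLeast0LessThan)
  \<comment> \<open>Inverts list lookup, to turn the coordinates of \<open>b\<close> into values
    attached to vertices.\<close>
  define pos where "pos = the_inv_into {..<?n} ((!) vs)"
  have pos: "pos (vs ! i) = i" if "i < ?n" for i
    unfolding pos_def using that vs by (intro the_inv_into_f_f) (auto simp: inj_on_nth)
  define w where "w v = ratfun_shift c (b $ pos v)" for v
  have reindex: "(\<Sum>v\<in>set vs. g v) = (\<Sum>i<?n. g (vs ! i))" for g :: "_ \<Rightarrow> real poly fract"
    using bij_betw_nth[OF vs refl refl] by (rule sum.reindex_bij_betw[symmetric])
  show ?thesis
  proof
    show "(\<Sum>v\<in>set vs. w v) = ratfun_shift c (coronal ?Q)"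
      by (simp add: reindex w_def pos cor ratfun_shift.hom_sum)
  next
    fix u assume "u \<in> set vs"
    then obtain i where i: "i < ?n" "u = vs ! i" by (metis in_set_conv_nth)
    \<comment> \<open>Shift row \<open>i\<close> of the system: the entries of Q are constants and
      stay fixed, while the indeterminate becomes \<open>ratfun_X + ratfun_const c\<close>.\<close>
    have "1 = ratfun_shift c ((?M *\<^sub>v b) $ i)" using i by (simp add: Mb)
    also have "\<dots> = (\<Sum>j<?n. ratfun_shift c (signless_pencil ratfun_X G u (vs ! j)) * ratfun_shift c (b $ j))"
      using i dimb by (simp add: scalar_prod_def atLeast0LessThan ratfun_shift.hom_sum ratfun_shift.hom_mult)
    also have "\<dots> = (\<Sum>v\<in>set vs. ratfun_shift c (signless_pencil ratfun_X G u v) * w v)"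
      by (simp add: reindex w_def pos)
    also have "\<dots> = (\<Sum>v\<in>set vs. signless_pencil (ratfun_X + ratfun_const c) G u v * w v)"
      by (intro sum.cong refl) (simp add: signless_pencil_def ratfun_X_def ratfun_const_def
          ratfun_shift.hom_minus ratfun_shift_to_fract pcompose_pCons flip: to_fract_add)
    finally show "(\<Sum>v\<in>set vs. signless_pencil (ratfun_X + ratfun_const c) G u v * w v) = 1"
      by simp
  qed
qed

section \<open>The signless Laplacian of the corona\<close>

lemma simple_graph_finite_edges: "simple_graph G \<Longrightarrow> finite (edges G)"
  unfolding simple_graph_def by (rule finite_subset[of _ "Pow (verts G)"]) auto

text \<open>The incidence matrix \<open>R\<close> satisfies \<open>R R\<^sup>T = Q\<close>.\<close>

lemma sum_incidence_signless_entry: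
  assumes "simple_graph G"
  shows "(\<Sum>e\<in>edges G. of_bool (u \<in> e) * of_bool (v \<in> e)) = signless_entry G u v"
proof -
  have fin: "finite (edges G)" using assms by (rule simple_graph_finite_edges)
  have card2: "card e = 2" if "e \<in> edges G" for e using assms that by (simp add: simple_graph_def)
  have "(\<Sum>e\<in>edges G. of_bool (u \<in> e) * of_bool (v \<in> e)) = real (card {e \<in> edges G. u \<in> e \<and> v \<in> e})"
    using fin by (simp add: sum_of_bool_eq Int_def flip: of_bool_conj)
  also have "\<dots> = signless_entry G u v"
  proof (cases "u = v")
    case True
    \<comment> \<open>Without loops the adjacency term vanishes on the diagonal, and the count is
      the degree.\<close>
    have "{v} \<notin> edges G" using card2[of "{v}"] by auto
    then show ?thesis using True by (simp add: signless_entry_def vertex_degree_def)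
  next
    case False
    \<comment> \<open>Two distinct vertices determine an edge through both, so the count is 0 or
      1.\<close>
    have "e = {u, v}" if "e \<in> edges G" "u \<in> e" "v \<in> e" for e
      using card2[OF that(1)] that(2,3) False by (auto simp: card_2_iff)
    then have "{e \<in> edges G. u \<in> e \<and> v \<in> e} = {{u, v}} \<inter> edges G" by blast
    then show ?thesis using False by (simp add: signless_entry_def)
  qed
  finally show ?thesis .
qed

section \<open>Edges, degrees and matrix blocks of the corona\<close>

context
  fixes G1 :: "'a sgraph" and G2 :: "'b sgraph"
begin

private abbreviation (input) "corona \<equiv> subdivision_vertex_corona G1 G2"

lemma corona_edges:
  "edges corona =
     {{Inl (Inl u), Inl (Inr e)} | u e. e \<in> edges G1 \<and> u \<in> e}
   \<union> {(\<lambda>w. Inr (u, w)) ` e | u e. u \<in> verts G1 \<and> e \<in> edges G2}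
   \<union> {{Inl (Inl u), Inr (u, w)} | u w. u \<in> verts G1 \<and> w \<in> verts G2}"
proof -
  let ?I = "{(u, e). e \<in> edges G1 \<and> u \<in> e}"
  have "edges (subdivision_graph G1) = (\<lambda>(u, e). {Inl u, Inr e}) ` ?I"
    by (auto simp: subdivision_graph_def image_def)
  then have "(\<lambda>e. Inl ` e) ` edges (subdivision_graph G1) =
      ((\<lambda>(u, e). {Inl (Inl u), Inl (Inr e)}) ` ?I :: (('a + 'a set) + 'a \<times> 'b) set set)"
    by (simp add: image_image case_prod_beta)
  also have "\<dots> = {{Inl (Inl u), Inl (Inr e)} | u e. e \<in> edges G1 \<and> u \<in> e}"
    by (auto simp: image_def)
  finally show ?thesis by (simp add: subdivision_vertex_corona_def)
qed

lemma Inl_notin_copy_edge: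
  "{Inl a, b} \<noteq> (\<lambda>w. Inr (u, w)) ` e" "{b, Inl a} \<noteq> (\<lambda>w. Inr (u, w)) ` e"
  by (auto simp: set_eq_iff)

lemma corona_edge_simps:
  "{Inl (Inl u), Inl (Inl u')} \<notin> edges corona"
  "{Inl (Inr e), Inl (Inr e')} \<notin> edges corona"
  "{Inl (Inl u), Inl (Inr e)} \<in> edges corona \<longleftrightarrow> e \<in> edges G1 \<and> u \<in> e"
  "{Inl (Inr e), Inl (Inl u)} \<in> edges corona \<longleftrightarrow> e \<in> edges G1 \<and> u \<in> e"
  "{Inl (Inr e), Inr p} \<notin> edges corona"
  "{Inr p, Inl (Inr e)} \<notin> edges corona"
  "{Inl (Inl u), Inr (u', w)} \<in> edges corona \<longleftrightarrow> u = u' \<and> u \<in> verts G1 \<and> w \<in> verts G2"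
  "{Inr (u', w), Inl (Inl u)} \<in> edges corona \<longleftrightarrow> u = u' \<and> u \<in> verts G1 \<and> w \<in> verts G2"
  by (auto simp: corona_edges doubleton_eq_iff Inl_notin_copy_edge)

lemma corona_edge_copy:
  "{Inr (u, w), Inr (u', w')} \<in> edges corona \<longleftrightarrow> u = u' \<and> u \<in> verts G1 \<and> {w, w'} \<in> edges G2"
proof -
  have "{Inr (u, w), Inr (u', w')} = (\<lambda>x. (Inr (v, x) :: ('a + 'a set) + 'a \<times> 'b)) ` e \<longleftrightarrow>
      v = u \<and> v = u' \<and> e = {w, w'}" for v e
  proof
    assume eq: "{Inr (u, w), Inr (u', w')} = (\<lambda>x. (Inr (v, x) :: ('a + 'a set) + 'a \<times> 'b)) ` e"
    \<comment> \<open>The tag \<open>v\<close> is read off from the elements; afterwards both sides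
      are images under one injective map.\<close>
    have "Inr (u, w) \<in> (\<lambda>x. (Inr (v, x) :: ('a + 'a set) + 'a \<times> 'b)) ` e"
      "Inr (u', w') \<in> (\<lambda>x. (Inr (v, x) :: ('a + 'a set) + 'a \<times> 'b)) ` e"
      by (simp_all flip: eq)
    then have "v = u" "v = u'" by auto
    with eq have "(\<lambda>x. (Inr (v, x) :: ('a + 'a set) + 'a \<times> 'b)) ` {w, w'} = (\<lambda>x. Inr (v, x)) ` e"
      by simp
    then have "{w, w'} = e" by (subst (asm) inj_image_eq_iff) (auto intro: injI)
    with \<open>v = u\<close> \<open>v = u'\<close> show "v = u \<and> v = u' \<and> e = {w, w'}" by simp
  qed auto
  then show ?thesis unfolding corona_edges by (auto simp: doubleton_eq_iff)
qed

text \<open>The edges at \<open>u\<close> are two disjoint injective images: one half-edge for each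
  edge of \<open>G1\<close> at \<open>u\<close>, and one edge for each vertex of its copy of
  \<open>G2\<close>.\<close>

lemma corona_degree_vertex:
  assumes "simple_graph G1" "simple_graph G2" "u \<in> verts G1"
  shows "vertex_degree corona (Inl (Inl u)) = vertex_degree G1 u + card (verts G2)"
proof -
  let ?f = "\<lambda>e. {Inl (Inl u), Inl (Inr e)} :: (('a + 'a set) + 'a \<times> 'b) set"
  let ?g = "\<lambda>w. {Inl (Inl u), Inr (u, w)} :: (('a + 'a set) + 'a \<times> 'b) set"
  have "{x \<in> edges corona. Inl (Inl u) \<in> x} = ?f ` {e \<in> edges G1. u \<in> e} \<union> ?g ` verts G2"
    unfolding corona_edges using assms by auto
  moreover have "card (?f ` {e \<in> edges G1. u \<in> e}) = card {e \<in> edges G1. u \<in> e}"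
    by (intro card_image inj_onI) (auto simp: doubleton_eq_iff)
  moreover have "card (?g ` verts G2) = card (verts G2)"
    by (intro card_image inj_onI) (auto simp: doubleton_eq_iff)
  moreover have "?f ` {e \<in> edges G1. u \<in> e} \<inter> ?g ` verts G2 = {}"
    by (auto simp: doubleton_eq_iff)
  moreover have "finite (verts G2)" using assms(2) by (simp add: simple_graph_def)
  ultimately show ?thesis
    using simple_graph_finite_edges[OF assms(1)] by (simp add: vertex_degree_def card_Un_disjoint)
qed

lemma corona_degree_edge:
  assumes "simple_graph G1" "e \<in> edges G1"
  shows "vertex_degree corona (Inl (Inr e)) = 2"
proof -
  let ?f = "\<lambda>u. {Inl (Inl u), Inl (Inr e)} :: (('a + 'a set) + 'a \<times> 'b) set"
  have "{x \<in> edges corona. Inl (Inr e) \<in> x} = ?f ` e"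
    unfolding corona_edges using assms by auto
  moreover have "card (?f ` e) = card e"
    by (intro card_image inj_onI) (auto simp: doubleton_eq_iff)
  ultimately show ?thesis
    using assms by (simp add: vertex_degree_def simple_graph_def)
qed

text \<open>The additional edge joins the copy to \<open>u\<close>; it is the source of the argument
  x - 1.\<close>

lemma corona_degree_copy:
  assumes "simple_graph G2" "u \<in> verts G1" "w \<in> verts G2"
  shows "vertex_degree corona (Inr (u, w)) = vertex_degree G2 w + 1"
proof -
  let ?f = "\<lambda>e. (\<lambda>w. Inr (u, w)) ` e :: (('a + 'a set) + 'a \<times> 'b) set"
  let ?j = "{Inl (Inl u), Inr (u, w)} :: (('a + 'a set) + 'a \<times> 'b) set"
  have "{x \<in> edges corona. Inr (u, w) \<in> x} = insert ?j (?f ` {e \<in> edges G2. w \<in> e})"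
    unfolding corona_edges using assms by auto
  moreover have "card (?f ` {e \<in> edges G2. w \<in> e}) = card {e \<in> edges G2. w \<in> e}"
    by (intro card_image inj_onI) (simp add: inj_image_eq_iff inj_def)
  moreover have "?j \<notin> ?f ` {e \<in> edges G2. w \<in> e}" by (auto simp: set_eq_iff)
  ultimately show ?thesis
    using simple_graph_finite_edges[OF assms(1)] by (simp add: vertex_degree_def)
qed

text \<open>These are the blocks of x I - Q for the corona. The two edge-vertex blocks facing
  \<open>G1\<close> are the negated incidence matrix and its transpose.\<close>

lemma corona_pencil_simps:
  assumes "simple_graph G1" "simple_graph G2"
  shows "u \<in> verts G1 \<Longrightarrow> signless_pencil x corona (Inl (Inl u)) (Inl (Inl u')) =
    (if u = u' then x - of_nat (vertex_degree G1 u) - of_nat (card (verts G2)) else 0)"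
  "e \<in> edges G1 \<Longrightarrow> signless_pencil x corona (Inl (Inr e)) (Inl (Inr e')) = (if e = e' then x - 2 else 0)"
  "e \<in> edges G1 \<Longrightarrow> signless_pencil x corona (Inl (Inr e)) (Inl (Inl u)) = - of_bool (u \<in> e)"
  "e \<in> edges G1 \<Longrightarrow> signless_pencil x corona (Inl (Inl u)) (Inl (Inr e)) = - of_bool (u \<in> e)"
  "signless_pencil x corona (Inl (Inr e)) (Inr p) = 0"
  "signless_pencil x corona (Inr p) (Inl (Inr e)) = 0"
  "u' \<in> verts G1 \<Longrightarrow> w \<in> verts G2 \<Longrightarrow>
    signless_pencil x corona (Inl (Inl u)) (Inr (u', w)) = - of_bool (u = u')"
  "u' \<in> verts G1 \<Longrightarrow> w \<in> verts G2 \<Longrightarrow>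
    signless_pencil x corona (Inr (u', w)) (Inl (Inl u)) = - of_bool (u = u')"
  "u \<in> verts G1 \<Longrightarrow> w \<in> verts G2 \<Longrightarrow> signless_pencil x corona (Inr (u, w)) (Inr (u', w')) =
    (if u = u' then signless_pencil (x - 1) G2 w w' else 0)"
  using assms ratfun_const.hom_of_nat[of 2]
  by (auto simp: signless_pencil_def signless_entry_def corona_edge_simps corona_edge_copy
      corona_degree_vertex corona_degree_edge corona_degree_copy
      ratfun_const.hom_of_nat ratfun_const.hom_add)

end

theorem theorem2p11:
  fixes G1 :: "'a sgraph" and G2 :: "'b sgraph"
    and r1 n1 m1 n2 :: nat
    and vs1 :: "'a list" and vs2 :: "'b list"
    and vs :: "(('a + 'a set) + 'a \<times> 'b) list"
    and \<Gamma> :: "real poly fract"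
  assumes "simple_graph G1" and "regular_graph r1 G1"
    and "card (verts G1) = n1" and "card (edges G1) = m1"
    and "simple_graph G2" and "card (verts G2) = n2"
    and "vertex_ordering G1 vs1" and "vertex_ordering G2 vs2"
    and "vertex_ordering (subdivision_vertex_corona G1 G2) vs"
  defines "\<Gamma> \<equiv> ratfun_shift (-1) (coronal (signless_laplacian G2 vs2))"
  shows "to_fract (char_poly (signless_laplacian (subdivision_vertex_corona G1 G2) vs)) =
      (ratfun_X - 2) powi (int m1 - int n1)
    * (\<Prod>i=1..n2. (ratfun_X - 1 - ratfun_const (signless_eigenvalue G2 vs2 i)) ^ n1)
    * (\<Prod>i=1..n1. ratfun_X ^ 2 - (2 + of_nat r1 + of_nat n2 + \<Gamma>) * ratfun_X
          + 2 * (of_nat r1 + of_nat n2 + \<Gamma>) - ratfun_const (signless_eigenvalue G1 vs1 i))"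
proof -
  let ?X = ratfun_X and ?C = "subdivision_vertex_corona G1 G2"
  note G = \<open>simple_graph G1\<close> \<open>simple_graph G2\<close>
  note pencil = corona_pencil_simps[OF G]
  have vs1: "distinct vs1" "set vs1 = verts G1" and vs2: "distinct vs2" "set vs2 = verts G2"
    and vs: "distinct vs" "set vs = verts ?C"
    using assms by (auto simp: vertex_ordering_def)
  have len: "length vs1 = n1" "length vs2 = n2"
    using assms vs1 vs2 by (metis distinct_card)+
  obtain es where es: "distinct es" "set es = edges G1"
    using simple_graph_finite_edges[OF G(1)] finite_distinct_list by metis
  have len_es: "length es = m1" using assms(4) es by (metis distinct_card)
  have fin: "finite (verts G1)" "finite (verts G2)" "finite (edges G1)"
    using vs1 vs2 es by (metis List.finite_set)+
  \<comment> \<open>Needed for the division by x - 2 in \<open>Y\<close> and for the possibly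
    negative exponent \<open>int m1 - int n1\<close>.\<close>
  have X2: "?X - 2 \<noteq> 0"
  proof -
    have "?X - 2 = to_fract ([:0, 1:] - [:2:])"
      by (simp only: to_fract_diff ratfun_X_def numeral_poly to_fract.hom_numeral flip: numeral_poly)
    also have "\<dots> \<noteq> 0" by (simp only: to_fract_eq_0_iff) simp
    finally show ?thesis .
  qed

  \<comment> \<open>Ordering of the corona and elimination of its leading block\<close>
  define es' :: "(('a + 'a set) + 'a \<times> 'b) list" where "es' = map (\<lambda>e. Inl (Inr e)) es"
  define ps :: "(('a + 'a set) + 'a \<times> 'b) list" where "ps = map Inr (List.product vs1 vs2)"
  define us :: "(('a + 'a set) + 'a \<times> 'b) list" where "us = map (\<lambda>u. Inl (Inl u)) vs1"
  have dist: "distinct ((es' @ ps) @ us)"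
    using es(1) vs1(1) vs2(1)
    by (auto simp: es'_def ps_def us_def distinct_map distinct_product inj_on_def)
  have verts: "set ((es' @ ps) @ us) = verts ?C"
    by (auto simp: es'_def ps_def us_def es vs1 vs2 subdivision_vertex_corona_def subdivision_graph_def)
  have sum_split: "(\<Sum>a\<in>set (es' @ ps). g a) = (\<Sum>e\<in>edges G1. g (Inl (Inr e))) +
      (\<Sum>u\<in>verts G1. \<Sum>w\<in>verts G2. g (Inr (u, w)))" for g :: "_ \<Rightarrow> real poly fract"
  proof -
    have "(\<Sum>a\<in>set (es' @ ps). g a) = (\<Sum>a\<in>set es'. g a) + (\<Sum>a\<in>set ps. g a)"
      unfolding set_append using dist by (intro sum.union_disjoint) auto
    also have "(\<Sum>a\<in>set es'. g a) = (\<Sum>e\<in>edges G1. g (Inl (Inr e)))"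
      by (simp add: es'_def es sum.reindex inj_on_def)
    also have "(\<Sum>a\<in>set ps. g a) = (\<Sum>u\<in>verts G1. \<Sum>w\<in>verts G2. g (Inr (u, w)))"
      by (simp add: ps_def vs1 vs2 sum.reindex inj_on_def sum.cartesian_product case_prod_beta)
    finally show ?thesis .
  qed

  have X1: "?X + ratfun_const (-1) = ?X - 1" by (simp add: ratfun_const.hom_uminus)
  \<comment> \<open>\<open>w\<close> solves ((x - 1) I - Q(G2)) w = 1 and has coordinate sum
    \<open>\<Gamma>\<close>.\<close>
  obtain w where w: "\<And>v. v \<in> verts G2 \<Longrightarrow> (\<Sum>v'\<in>verts G2. signless_pencil (?X - 1) G2 v v' * w v') = 1"
    and sum_w: "(\<Sum>v\<in>verts G2. w v) = \<Gamma>"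
    using coronal_solution[OF vs2(1), of "-1" G2] unfolding X1 \<Gamma>_def vs2(2) by blast
  define F where "F = signless_pencil ?X ?C"
  \<comment> \<open>The solution demanded by \<open>det_indexed_mat_append_schur\<close>, found
    blockwise: for edge vertices the right-hand side -[u in e] is divided by x - 2; on the copy
    belonging to \<open>u\<close> the right-hand side is -1, with solution \<open>- w\<close>, and
    on other copies it is 0. \<open>projl\<close> and \<open>projr\<close> strip the constructors of
    the labels.\<close>
  define Y :: "(('a + 'a set) + 'a \<times> 'b) \<Rightarrow> (('a + 'a set) + 'a \<times> 'b) \<Rightarrow> real poly fract" where
    "Y a b = (let u = projl (projl b) in case a of
        Inl a' \<Rightarrow> - (of_bool (u \<in> projr a') / (?X - 2))
      | Inr (u', v) \<Rightarrow> - (of_bool (u = u') * w v))" for a b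
  have Y_simps: "Y (Inl (Inr e)) (Inl (Inl u)) = - (of_bool (u \<in> e) / (?X - 2))"
    "Y (Inr (u', v)) (Inl (Inl u)) = - (of_bool (u = u') * w v)" for e u u' v
    by (simp_all add: Y_def)
  have FY: "(\<Sum>a'\<in>set (es' @ ps). F a a' * Y a' b) = F a b"
    if a: "a \<in> set (es' @ ps)" and b: "b \<in> set us" for a b
  proof -
    from b obtain u where u: "u \<in> verts G1" "b = Inl (Inl u)" by (auto simp: us_def vs1)
    from a consider e where "e \<in> edges G1" "a = Inl (Inr e)"
      | u' v where "u' \<in> verts G1" "v \<in> verts G2" "a = Inr (u', v)"
      by (auto simp: es'_def ps_def es vs1 vs2)
    then show ?thesis
    proof cases
      case 1
      then show ?thesis unfolding sum_split using u X2 fin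
        by (simp add: F_def pencil Y_simps mult_delta_left sum_negf flip: sum_divide_distrib)
    next
      case 2
      \<comment> \<open>Only the copy containing \<open>a\<close> contributes, and there the
        equation for \<open>w\<close> turns the inner sum into 1.\<close>
      have "(\<Sum>u''\<in>verts G1. \<Sum>v'\<in>verts G2. F a (Inr (u'', v')) * Y (Inr (u'', v')) b) =
          (\<Sum>u''\<in>verts G1. if u' = u'' then
            \<Sum>v'\<in>verts G2. signless_pencil (?X - 1) G2 v v' * - (of_bool (u = u') * w v') else 0)"
        using 2 u by (intro sum.cong refl) (simp add: F_def pencil Y_simps)
      also have "\<dots> = - (of_bool (u = u') * (\<Sum>v'\<in>verts G2. signless_pencil (?X - 1) G2 v v' * w v'))"
        using 2 fin by (simp add: sum.delta' sum_distrib_left sum_negf mult_ac)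
      also have "\<dots> = F a b" using 2 u by (simp add: w F_def pencil)
      finally show ?thesis unfolding sum_split using 2 by (simp add: F_def pencil)
    qed
  qed

  \<comment> \<open>The Schur complement on the vertices of \<open>G1\<close>\<close>
  define c where "c = (?X - 2) * (?X - of_nat r1 - of_nat n2 - \<Gamma>)"
  have schur: "F (Inl (Inl u)) (Inl (Inl u')) - (\<Sum>a\<in>set (es' @ ps). F (Inl (Inl u)) a * Y a (Inl (Inl u'))) =
      inverse (?X - 2) * signless_pencil c G1 u u'" if "u \<in> verts G1" "u' \<in> verts G1" for u u'
  proof -
    \<comment> \<open>The two minus signs cancel, and the incidence sums assemble to Q(G1) divided
      by x - 2.\<close>
    have "(\<Sum>e\<in>edges G1. F (Inl (Inl u)) (Inl (Inr e)) * Y (Inl (Inr e)) (Inl (Inl u'))) =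
        (\<Sum>e\<in>edges G1. ratfun_const (of_bool (u \<in> e) * of_bool (u' \<in> e)) / (?X - 2))"
      by (intro sum.cong refl) (simp add: F_def pencil Y_simps)
    also have "\<dots> = ratfun_const (signless_entry G1 u u') / (?X - 2)"
      by (simp add: sum_incidence_signless_entry[OF G(1)]
          flip: sum_divide_distrib ratfun_const.hom_sum)
    finally have 1: "(\<Sum>e\<in>edges G1. F (Inl (Inl u)) (Inl (Inr e)) * Y (Inl (Inr e)) (Inl (Inl u'))) =
        ratfun_const (signless_entry G1 u u') / (?X - 2)" .
    \<comment> \<open>A path through a copy returns to the same vertex, so only the diagonal
      receives the sum of \<open>w\<close>.\<close>
    have "(\<Sum>u''\<in>verts G1. \<Sum>v\<in>verts G2. F (Inl (Inl u)) (Inr (u'', v)) * Y (Inr (u'', v)) (Inl (Inl u'))) =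
        (\<Sum>u''\<in>verts G1. if u = u'' then if u = u' then \<Gamma> else 0 else 0)"
      by (intro sum.cong refl) (simp add: F_def pencil Y_simps sum_w)
    also have "\<dots> = (if u = u' then \<Gamma> else 0)" using that fin by (simp add: sum.delta')
    finally have 2: "(\<Sum>u''\<in>verts G1. \<Sum>v\<in>verts G2. F (Inl (Inl u)) (Inr (u'', v)) *
        Y (Inr (u'', v)) (Inl (Inl u'))) = (if u = u' then \<Gamma> else 0)" .
    \<comment> \<open>Regularity makes the diagonal a scalar matrix, so that one \<open>c\<close>
      serves all vertices and \<open>det_signless_pencil\<close> applies.\<close>
    have "vertex_degree G1 u = r1" using assms(2) that by (simp add: regular_graph_def)
    then have 3: "F (Inl (Inl u)) (Inl (Inl u')) = (if u = u' then ?X - of_nat r1 - of_nat n2 else 0)"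
      using that assms(6) by (auto simp: F_def pencil)
    show ?thesis
      unfolding sum_split 1 2 3 using X2 by (simp add: signless_pencil_def c_def field_simps)
  qed

  \<comment> \<open>The three determinants and their product\<close>
  have det_es: "det (indexed_mat es' es' F) = (?X - 2) ^ m1"
  proof -
    have "indexed_mat es' es' F = indexed_mat es es (\<lambda>e e'. if e = e' then ?X - 2 else 0)"
      unfolding es'_def indexed_mat_map F_def by (intro indexed_mat_cong) (simp add: es pencil)
    then show ?thesis by (simp add: det_indexed_mat_scalar es len_es)
  qed
  have det_ps: "det (indexed_mat ps ps F) =
      (\<Prod>i=1..n2. (?X - 1 - ratfun_const (signless_eigenvalue G2 vs2 i)) ^ n1)"
  proof -
    have "indexed_mat ps ps F = indexed_mat (List.product vs1 vs2) (List.product vs1 vs2)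
        (\<lambda>(u, v) (u', v'). if u = u' then signless_pencil (?X - 1) G2 v v' else 0)"
      unfolding ps_def indexed_mat_map F_def
      by (intro indexed_mat_cong) (auto simp: vs1 vs2 pencil)
    then show ?thesis
      by (simp add: det_indexed_mat_product vs1 len det_signless_pencil vs2 prod_power_distrib)
  qed
  have det_us: "det (indexed_mat us us (\<lambda>b b'. F b b' - (\<Sum>a\<in>set (es' @ ps). F b a * Y a b'))) =
      inverse (?X - 2) ^ n1 * (\<Prod>i=1..n1. c - ratfun_const (signless_eigenvalue G1 vs1 i))"
  proof -
    have "indexed_mat us us (\<lambda>b b'. F b b' - (\<Sum>a\<in>set (es' @ ps). F b a * Y a b')) =
        indexed_mat vs1 vs1 (\<lambda>u u'. inverse (?X - 2) * signless_pencil c G1 u u')"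
      unfolding us_def indexed_mat_map by (intro indexed_mat_cong schur) (simp_all add: vs1)
    then show ?thesis
      by (simp add: det_indexed_mat_smult det_signless_pencil vs1 len)
  qed
  have "to_fract (char_poly (signless_laplacian ?C vs)) = det (indexed_mat vs vs F)"
    unfolding F_def using vs(1) by (rule to_fract_char_poly_signless_laplacian)
  also have "\<dots> = det (indexed_mat ((es' @ ps) @ us) ((es' @ ps) @ us) F)"
    using vs dist verts by (intro det_indexed_mat_reorder) simp_all
  also have "\<dots> = det (indexed_mat (es' @ ps) (es' @ ps) F) *
      det (indexed_mat us us (\<lambda>b b'. F b b' - (\<Sum>a\<in>set (es' @ ps). F b a * Y a b')))"
    using dist FY by (intro det_indexed_mat_append_schur) auto
  also have "det (indexed_mat (es' @ ps) (es' @ ps) F) =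
      det (indexed_mat es' es' F) * det (indexed_mat ps ps F)"
    by (intro det_indexed_mat_append_triangular) (auto simp: es'_def ps_def F_def pencil)
  also have "det (indexed_mat es' es' F) * det (indexed_mat ps ps F) *
      det (indexed_mat us us (\<lambda>b b'. F b b' - (\<Sum>a\<in>set (es' @ ps). F b a * Y a b'))) =
      ((?X - 2) ^ m1 * inverse (?X - 2) ^ n1) *
      (\<Prod>i=1..n2. (?X - 1 - ratfun_const (signless_eigenvalue G2 vs2 i)) ^ n1) *
      (\<Prod>i=1..n1. c - ratfun_const (signless_eigenvalue G1 vs1 i))"
    unfolding det_es det_ps det_us by (simp only: mult_ac)
  \<comment> \<open>The edge vertices give \<open>m1\<close> factors x - 2, and the scalar taken out
    of the Schur complement gives \<open>n1\<close> inverse ones.\<close>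
  also have "(?X - 2) ^ m1 * inverse (?X - 2) ^ n1 = (?X - 2) powi (int m1 - int n1)"
    using X2 by (simp add: power_int_diff power_inverse divide_inverse)
  also have "c = ?X ^ 2 - (2 + of_nat r1 + of_nat n2 + \<Gamma>) * ?X + 2 * (of_nat r1 + of_nat n2 + \<Gamma>)"
    by (simp add: c_def algebra_simps power2_eq_square)
  finally show ?thesis .
qed

end
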